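(* Let $X$ be a finite topological $T_0$-space and let $\varphi:\mathbb{R}_0^+\times X\rightarrow X$ be a non-trivial semiflow. Then there is a continuous map $r:X\to X$ such that $\varphi(t,\cdot)=r$ for every real $t>0$, the map $r:X\rightarrow r(X)$ is a retraction, and $r(X)$ is a strong deformation retract of $X$.
   Context: $\mathbb{R}_0^+$ is the set of non-negative real numbers with the usual topology. A semiflow on $X$ is a continuous map $\varphi:\mathbb{R}_0^+\times X\to X$ (product topology on the domain) such that $\varphi(0,x)=x$ for all $x\in X$ and $\varphi(s,\varphi(t,x))=\varphi(s+t,x)$ for all $x\in X$, $s,t\in\mathbb{R}_0^+$. It is trivial if $\varphi(t,\cdot)$ is the identity map of $X$ for every $t\in\mathbb{R}_0^+$, and non-trivial otherwise. For a subspace $A\subseteq X$ with inclusion $i:A\to X$, a retraction $r:X\to A$ is a continuous map with $r(a)=a$ for all $a\in A$. $A$ is a strong deformation retract of $X$ if there is a retraction $\rho:X\to A$ such that $i\circ\rho$ is homotopic to the identity map of $X$ by a homotopy leaving the points of $A$ fixed. *)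

theory Defs
  imports "HOL-Analysis.Analysis"
begin

text \<open>
  The values of a semiflow at negative times or at points outside \<open>topspace X\<close> are irrelevant.
\<close>
definition semiflow :: "'a topology \<Rightarrow> (real \<times> 'a \<Rightarrow> 'a) \<Rightarrow> bool" where
  "semiflow X \<phi> \<longleftrightarrow>
     continuous_map (prod_topology (top_of_set {0..}) X) X \<phi> \<and>
     (\<forall>x\<in>topspace X. \<phi> (0, x) = x) \<and>
     (\<forall>x\<in>topspace X. \<forall>s\<ge>0. \<forall>t\<ge>0. \<phi> (s, \<phi> (t, x)) = \<phi> (s + t, x))"

definition trivial_semiflow :: "'a topology \<Rightarrow> (real \<times> 'a \<Rightarrow> 'a) \<Rightarrow> bool" where
  "trivial_semiflow X \<phi> \<longleftrightarrow> semiflow X \<phi> \<and> (\<forall>t\<ge>0. \<forall>x\<in>topspace X. \<phi> (t, x) = x)"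

text \<open>
  Retractions onto a subspace \<open>A\<close> are expressed as \<open>retraction_maps X (subtopology X A) r id\<close>,
  where \<open>id\<close> plays the role of the inclusion \<open>i\<close>; accordingly, \<open>i \<circ> \<rho>\<close> is just \<open>\<rho>\<close>
  seen as a map from \<open>X\<close> to \<open>X\<close>.
\<close>
definition strong_deformation_retract_of_space :: "'a set \<Rightarrow> 'a topology \<Rightarrow> bool" where
  "strong_deformation_retract_of_space A X \<longleftrightarrow>
     A \<subseteq> topspace X \<and>
     (\<exists>\<rho>. retraction_maps X (subtopology X A) \<rho> id \<and>
          homotopic_with (\<lambda>h. \<forall>a\<in>A. h a = a) X X \<rho> id)"

end

theory Submission
  imports Defs
begin

text \<open>
  Order \<open>X\<close> by specialization. By continuity at time \<open>0\<close>, every small time map moves points only in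
  one direction of this order, so each orbit is monotone for small times; as \<open>X\<close> is finite and
  \<open>T\<^sub>0\<close>, it is constant for small positive times, with a common bound for all
  points. Since every positive time is a multiple of an arbitrarily small one, the semigroup law
  makes all positive time maps equal to one idempotent map, and the reversed flow on \<open>[0, 1]\<close> is
  the required homotopy.
\<close>

text \<open>Inclusion between these sets encodes the specialization preorder. For finite
  \<open>topspace X\<close> they are finite, so their cardinality can serve as a rank.\<close>

definition open_nhds :: "'a topology \<Rightarrow> 'a \<Rightarrow> 'a set set" where
  "open_nhds X x = {U. openin X U \<and> x \<in> U}"

lemma finite_open_nhds:
  assumes "finite (topspace X)"
  shows "finite (open_nhds X x)"
  by (rule finite_subset[of _ "Pow (topspace X)"])
    (use assms in \<open>auto simp: open_nhds_def dest: openin_subset\<close>)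

lemma t0_space_open_nhds_eqD:
  assumes "t0_space X" "x \<in> topspace X" "y \<in> topspace X" "open_nhds X x = open_nhds X y"
  shows "x = y"
  using assms unfolding t0_space_def open_nhds_def by blast

lemma semiflow_closed:
  assumes "semiflow X \<phi>" "t \<ge> 0" "x \<in> topspace X"
  shows "\<phi> (t, x) \<in> topspace X"
  using assms by (auto simp: semiflow_def continuous_map_def)

lemma semiflow_add:
  assumes "semiflow X \<phi>" "s \<ge> 0" "t \<ge> 0" "x \<in> topspace X"
  shows "\<phi> (s + t, x) = \<phi> (s, \<phi> (t, x))"
  using assms by (simp add: semiflow_def)

lemma continuous_map_semiflow_time:
  assumes "semiflow X \<phi>" "t \<ge> 0"
  shows "continuous_map X X (\<lambda>x. \<phi> (t, x))"
proof -
  have "continuous_map X (prod_topology (top_of_set {0..}) X) (\<lambda>x. (t, x))"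
    using assms by (intro continuous_map_pairedI) auto
  with assms show ?thesis
    by (auto simp: semiflow_def o_def dest: continuous_map_compose)
qed

lemma continuous_map_semiflow_orbit:
  assumes "semiflow X \<phi>" "x \<in> topspace X"
  shows "continuous_map (top_of_set {0..}) X (\<lambda>t. \<phi> (t, x))"
proof -
  have "continuous_map (top_of_set {0..}) (prod_topology (top_of_set {0..}) X) (\<lambda>t. (t, x))"
    using assms by (intro continuous_map_pairedI) auto
  with assms show ?thesis
    by (auto simp: semiflow_def o_def dest: continuous_map_compose)
qed

lemma semiflow_eventually_in_open:
  assumes "semiflow X \<phi>" "x \<in> topspace X" "openin X U" "x \<in> U"
  shows "eventually (\<lambda>t. \<phi> (t, x) \<in> U) (at_right 0)"
proof -
  have "openin (top_of_set {0..}) {t \<in> {0..}. \<phi> (t, x) \<in> U}"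
    using openin_continuous_map_preimage[OF continuous_map_semiflow_orbit[OF assms(1,2)] assms(3)]
    by simp
  moreover have "(0::real) \<in> {t \<in> {0..}. \<phi> (t, x) \<in> U}"
    using assms by (simp add: semiflow_def)
  ultimately obtain e where e: "e > 0" "ball 0 e \<inter> {0..} \<subseteq> {t \<in> {0..}. \<phi> (t, x) \<in> U}"
    unfolding openin_contains_ball by blast
  show ?thesis
    unfolding eventually_at_right_field
    by (rule exI[of _ e]) (use e in \<open>auto simp: subset_iff\<close>)
qed

text \<open>Each orbit is continuous at time 0 and so stays briefly in any given open neighbourhood
  of its start. Only finitely many points and open sets occur, so one time bound works for all of
  them.\<close>

lemma semiflow_eventually_open_nhds_mono:
  assumes "finite (topspace X)" "semiflow X \<phi>"
  shows "eventually (\<lambda>t. \<forall>x\<in>topspace X. open_nhds X x \<subseteq> open_nhds X (\<phi> (t, x))) (at_right 0)"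
proof (rule eventually_ball_finite[OF assms(1)], rule ballI)
  fix x assume x: "x \<in> topspace X"
  have "eventually (\<lambda>t. \<forall>U\<in>open_nhds X x. \<phi> (t, x) \<in> U) (at_right 0)"
    by (rule eventually_ball_finite[OF finite_open_nhds[OF assms(1)]])
      (use semiflow_eventually_in_open[OF assms(2) x] in \<open>auto simp: open_nhds_def\<close>)
  then show "eventually (\<lambda>t. open_nhds X x \<subseteq> open_nhds X (\<phi> (t, x))) (at_right 0)"
    by (rule eventually_mono) (auto simp: open_nhds_def)
qed

lemma semiflow_eventually_constant:
  assumes fin: "finite (topspace X)" and "t0_space X" and sf: "semiflow X \<phi>"
  obtains v where "eventually (\<lambda>t. \<forall>x\<in>topspace X. \<phi> (t, x) = v x) (at_right 0)"
proof -
  obtain e where e: "e > 0"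
    "\<And>t x. 0 < t \<Longrightarrow> t < e \<Longrightarrow> x \<in> topspace X \<Longrightarrow> open_nhds X x \<subseteq> open_nhds X (\<phi> (t, x))"
    using semiflow_eventually_open_nhds_mono[OF fin sf] unfolding eventually_at_right_field by blast
  have "\<exists>v. eventually (\<lambda>t. \<phi> (t, x) = v) (at_right 0)" if x: "x \<in> topspace X" for x
  proof -
    define N where "N t = open_nhds X (\<phi> (t, x))" for t
    \<comment> \<open>Orbits only gain neighbourhoods as time increases, so a time of least rank
      leaves no room for a change before it.\<close>
    obtain t where t: "0 < t" "t < e" and least: "\<And>s. 0 < s \<and> s < e \<Longrightarrow> card (N t) \<le> card (N s)"
      using ex_has_least_nat[of "\<lambda>t. 0 < t \<and> t < e" "e / 2" "\<lambda>t. card (N t)"] e(1) by auto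
    have "\<phi> (s, x) = \<phi> (t, x)" if s: "0 < s" "s < t" for s
    proof -
      \<comment> \<open>The bound \<open>e\<close> is applied at the moved point
        \<open>\<phi> (s, x)\<close>, which is why it had to be uniform over the space.\<close>
      have "\<phi> (t, x) = \<phi> (t - s, \<phi> (s, x))"
        using semiflow_add[OF sf, of "t - s" s x] s x by simp
      then have "N s \<subseteq> N t"
        using e(2)[of "t - s" "\<phi> (s, x)"] semiflow_closed[OF sf _ x, of s] s t by (simp add: N_def)
      then have "N s = N t"
        using least[of s] s t finite_open_nhds[OF fin] by (intro card_seteq) (auto simp: N_def)
      then show ?thesis
        using t0_space_open_nhds_eqD[OF assms(2)] semiflow_closed[OF sf _ x] s
        by (simp add: N_def)
    qed
    then show ?thesis
      unfolding eventually_at_right_field using t(1) by blast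
  qed
  then obtain v where "\<forall>x\<in>topspace X. eventually (\<lambda>t. \<phi> (t, x) = v x) (at_right 0)"
    by metis
  then show thesis
    by (intro that[of v] eventually_ball_finite[OF fin])
qed

text \<open>A positive time is split into equal steps short enough to act as the map
  \<open>v\<close>; as \<open>v\<close> is idempotent, their composite is \<open>v\<close>
  again.\<close>

lemma semiflow_positive_times_eq:
  assumes "finite (topspace X)" "t0_space X" and sf: "semiflow X \<phi>"
    and "s > 0" "t > 0" and x: "x \<in> topspace X"
  shows "\<phi> (s, x) = \<phi> (t, x)"
proof -
  obtain v where "eventually (\<lambda>t. \<forall>x\<in>topspace X. \<phi> (t, x) = v x) (at_right 0)"
    using semiflow_eventually_constant[OF assms(1-3)] .
  then obtain d where d: "d > 0" "\<And>t x. 0 < t \<Longrightarrow> t < d \<Longrightarrow> x \<in> topspace X \<Longrightarrow> \<phi> (t, x) = v x"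
    unfolding eventually_at_right_field by blast
  have v_closed: "v x \<in> topspace X"
    using semiflow_closed[OF sf _ x, of "d / 2"] d(2)[of "d / 2" x] d(1) x by simp
  \<comment> \<open>Two steps of length \<open>d / 3\<close> add up to a time still below
    \<open>d\<close>, so the double step and each single step are all given by
    \<open>v\<close>.\<close>
  have v_idem: "v (v x) = v x"
    using semiflow_add[OF sf, of "d / 3" "d / 3" x] d(2)[of "d / 3"] d(2)[of "d / 3 + d / 3" x]
      d(1) x v_closed by simp
  have "\<phi> (t, x) = v x" if t: "t > 0" for t
  proof -
    obtain n where n: "t / d < real n"
      using reals_Archimedean2 by blast
    then have "n > 0"
      using t d(1) by (cases n) (auto simp: field_simps)
    define s where "s = t / real n"
    have s: "0 < s" "s < d"
      using n t d(1) \<open>n > 0\<close> by (auto simp: s_def field_simps)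
    \<comment> \<open>\<open>Suc k\<close> keeps the time positive, since at time 0 the value is
      \<open>x\<close> rather than \<open>v x\<close>. The case \<open>k = n - 1\<close> gives the
      time \<open>t\<close>.\<close>
    have "\<phi> (real (Suc k) * s, x) = v x" for k
    proof (induction k)
      case 0
      then show ?case using d(2) s x by simp
    next
      case (Suc k)
      have "\<phi> (real (Suc (Suc k)) * s, x) = \<phi> (s + real (Suc k) * s, x)"
        by (simp add: algebra_simps)
      also have "\<dots> = \<phi> (s, v x)"
        using semiflow_add[OF sf, of s "real (Suc k) * s" x] s x Suc by simp
      finally show ?case
        using d(2) s v_closed v_idem by simp
    qed
    from this[of "n - 1"] show ?thesis
      using \<open>n > 0\<close> by (simp add: s_def)
  qed
  then show ?thesis
    using assms(4,5) by simp
qed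

theorem theorem3p8:
  fixes X :: "'a topology" and \<phi> :: "real \<times> 'a \<Rightarrow> 'a"
  assumes "finite (topspace X)"
    and "t0_space X"
    and "semiflow X \<phi>"
    and "\<not> trivial_semiflow X \<phi>"
  shows "\<exists>r. continuous_map X X r \<and>
             (\<forall>t>0. \<forall>x\<in>topspace X. \<phi> (t, x) = r x) \<and>
             retraction_maps X (subtopology X (r ` topspace X)) r id \<and>
             strong_deformation_retract_of_space (r ` topspace X) X"
proof -
  note sf = assms(3)
  define r where "r x = \<phi> (1, x)" for x
  define A where "A = r ` topspace X"
  have r_eq: "\<phi> (t, x) = r x" if "t > 0" "x \<in> topspace X" for t x
    unfolding r_def by (rule semiflow_positive_times_eq[OF assms(1-3)]) (use that in auto)
  have r_cont: "continuous_map X X r"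
    unfolding r_def using continuous_map_semiflow_time[OF sf] by simp
  then have A_sub: "A \<subseteq> topspace X"
    by (auto simp: A_def continuous_map_def)
  \<comment> \<open>A point of \<open>A\<close> has already flowed for time 1, and
    \<open>t + 1\<close> is again a positive time, so flowing further changes nothing. This makes
    \<open>r\<close> a retraction and keeps \<open>A\<close> fixed during the homotopy.\<close>
  have fixed: "\<phi> (t, a) = a" if "t \<ge> 0" "a \<in> A" for t a
  proof -
    from that obtain x where x: "x \<in> topspace X" "a = \<phi> (1, x)"
      by (auto simp: A_def r_def)
    then have "\<phi> (t, a) = \<phi> (t + 1, x)"
      using semiflow_add[OF sf] that by simp
    also have "\<dots> = a"
      using r_eq[of "t + 1" x] x that by (simp add: r_def)
    finally show ?thesis .
  qed
  have retr: "retraction_maps X (subtopology X A) r id"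
    unfolding retraction_maps_def
  proof (intro conjI)
    show "continuous_map X (subtopology X A) r"
      using r_cont by (auto simp: continuous_map_in_subtopology A_def)
    show "continuous_map (subtopology X A) X id"
      by (simp add: continuous_map_from_subtopology)
    show "\<forall>x\<in>topspace (subtopology X A). r (id x) = x"
      using fixed by (simp add: r_def)
  qed
  have "homotopic_with (\<lambda>h. \<forall>a\<in>A. h a = a) X X r id"
  proof -
    \<comment> \<open>Time is reversed because the homotopy has to start at \<open>r\<close>, the
      map at time 1, and end at the identity, the map at time 0.\<close>
    have "continuous_map (prod_topology (top_of_set {0..1}) X) (top_of_set {0..})
        (\<lambda>p. 1 - fst p :: real)"
    proof -
      have "continuous_map (top_of_set {0..1}) (top_of_set {0..}) (\<lambda>u. 1 - u :: real)"
        by (auto intro!: continuous_intros)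
      from continuous_map_compose[OF continuous_map_fst this] show ?thesis
        by (simp add: o_def)
    qed
    then have "continuous_map (prod_topology (top_of_set {0..1}) X)
        (prod_topology (top_of_set {0..}) X) (\<lambda>p. (1 - fst p :: real, snd p))"
      by (intro continuous_map_pairedI continuous_map_snd)
    then have "continuous_map (prod_topology (top_of_set {0..1}) X) X
        (\<lambda>p. \<phi> (1 - fst p, snd p))"
      using sf by (auto simp: semiflow_def o_def dest: continuous_map_compose)
    moreover have "\<phi> (0, x) = x" if "x \<in> topspace X" for x
      using sf that by (simp add: semiflow_def)
    \<comment> \<open>The rule \<open>homotopic_with\<close> requires a property that depends only
      on the values of the map on \<open>topspace X\<close>.\<close>
    moreover have "(\<forall>a\<in>A. h a = a) \<longleftrightarrow> (\<forall>a\<in>A. k a = a)"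
      if "\<And>x. x \<in> topspace X \<Longrightarrow> h x = k x" for h k :: "'a \<Rightarrow> 'a"
      using that A_sub by (metis subsetD)
    ultimately show ?thesis
      by (subst homotopic_with, blast)
        (intro exI[of _ "\<lambda>p. \<phi> (1 - fst p, snd p)"], simp add: r_def fixed)
  qed
  with retr A_sub have "strong_deformation_retract_of_space A X"
    unfolding strong_deformation_retract_of_space_def by blast
  with retr r_cont r_eq show ?thesis
    unfolding A_def by blast
qed

end
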